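(* Let $p\ge1$ be an integer. For every quarter-plane $p$-tandem walk $\bar w\in\mathcal T_p$, the raising algorithm and the RL transducer algorithm, both applied to $\bar w$, produce the same output word in $\Sigma_p^*$; that is, the output of the raising algorithm on $\bar w$ is $\Psi_p(\bar w)$.
   Context: Fix an integer $p\ge1$; $\mathbb N$ contains $0$; $A^*$ is the set of finite words on $A$, with empty word $\epsilon$; $|w|$ is the length of a word. Alphabets: $\Sigma_p=\{-1,0,1,\dots,p\}$; $S_p=\{(-j,p-j):0\le j\le p\}\cup\{(1,-1)\}\subset\mathbb Z^2$; $A_p=\{a_{\ell,m}:\ell,m\in\mathbb N,\ 0\le\ell+m\le p-1\}$ (formal letters). $\mathcal T_p$ is the set of words $\bar w\in S_p^*$ such that for every prefix the sum of its letters lies in $\mathbb N^2$. Transitions, written $\mu;\ (H_L,v_L)\to(H_R,v_R);\ \bar a$ with $\mu\in\Sigma_p$, $(H_L,v_L),(H_R,v_R)\in A_p^*\times\mathbb N$, $\bar a\in S_p$, and arbitrary $\Lambda\in A_p^*$, $\beta\in\mathbb N$, $a_{\ell,m}\in A_p$: (T1) $p;\ (\Lambda,\beta)\to(\Lambda,\beta+p);\ (0,p)$. (T2) $q;\ (\Lambda,0)\to(\Lambda,q);\ (0,p)$, for $0\le q\le p-1$. (T3) $-1;\ (\Lambda a_{\ell,m},0)\to(\Lambda,\ell);\ (-m-1,p-m-1)$, for $\ell+m\le p-1$. (T4) $-1;\ (\Lambda a_{\ell,m},\beta+1)\to(\Lambda,\beta+\ell+1);\ (-m-1,p-m-1)$,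 for $\ell+m=p-1$. (T5) $q;\ (\Lambda,\beta+1)\to(\Lambda a_{q,0},\beta);\ (1,-1)$, for $0\le q\le p-1$. (T6) $-1;\ (\Lambda a_{\ell,m},\beta+1)\to(\Lambda a_{\ell,m+1},\beta);\ (1,-1)$, for $\ell+m\le p-2$. (T7) $-1;\ (\epsilon,\beta+1)\to(\epsilon,\beta);\ (1,-1)$. Each triple $(H_R,v_R,\bar a)\in A_p^*\times\mathbb N\times S_p$ matches the right side of exactly one of these and determines $(\mu,H_L,v_L)$. RL transducer algorithm ($\Psi_p$): given $\bar w=\bar a_1\cdots\bar a_n\in S_p^*$, start with $(H_n,v_n)=(\epsilon,0)$; for $i=n,n-1,\dots,1$ apply in reverse the unique transition matching $(H_i,v_i,\bar a_i)$ to get $w_i\in\Sigma_p$ and $(H_{i-1},v_{i-1})$. The output is $\Psi_p(\bar w)=w_1\cdots w_n$. Raising algorithm. It uses decorated letters $(\mu)^{j,t}$ with $\mu\in\Sigma_p$, an integer $j\ge0$ (the raisability) and an integer $t\ge-1$ (the modality). Input: $\bar a_1\cdots\bar a_n\in\mathcal T_p$. Set $L_0=\epsilon$. For $i=1,\dots,n$ define $L_i$ (a word of length $i$ in decorated letters) from $L_{i-1}$ and $\bar a_i$: (a) If $\bar a_i=(0,p)$, then $L_i=L_{i-1}\,(0)^{p,0}$. (b) If $\bar a_i=(1,-1)$, write $L_{i-1}=w\,(\mu)^{j,t}\,w'$ with $j>0$, $t\ge0$ and $w'$ having no letter with both raisability $>0$ and modality $\ge0$. If $t=0$, then $L_i=w\,(\mu+1)^{j-1,0}\,w'\,(-1)^{1,-1}$.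 If $t>0$, rewrite $L_{i-1}=w''\,(\mu')^{0,-1}\,w'''\,(\mu)^{j,t}\,w'$ with $|w'''|=t-1$ and set $L_i=w''\,(\mu'+1)^{0,-1}\,w'''\,(\mu)^{j-1,t}\,w'\,(-1)^{1,-1}$. (c) If $\bar a_i=(-m,p-m)$ with $1\le m\le p$, write $L_{i-1}=w_0\,(\mu_1)^{j_1,-1}\,w_1\,(\mu_2)^{j_2,-1}\,w_2\cdots w_{m-1}\,(\mu_m)^{j_m,-1}\,w_m$ where for each $\ell\in\{1,\dots,m\}$, $j_\ell>0$ and $w_\ell$ has no letter with both raisability $>0$ and modality $-1$; then set $L_i=w_0\,(\mu_1+1)^{0,-1}\,w_1\,(\mu_2)^{0,-1}\,w_2\cdots w_{m-1}\,(\mu_m)^{0,-1}\,w_m\,(-1)^{p-m,d}$ where $d=i-1-|w_0|$. Finally, replace each decorated letter $(\mu)^{j,t}$ of $L_n$ by $\mu$ and return the resulting word. (For inputs in $\mathcal T_p$ the required factorizations exist.) *)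

theory Defs
  imports Main "HOL-Library.Sublist" "HOL-Library.Product_Plus"
begin

definition Sigma_alph :: "nat \<Rightarrow> int set" where
  "Sigma_alph p = {-1..int p}"

definition S_alph :: "nat \<Rightarrow> (int \<times> int) set" where
  "S_alph p = {(- int j, int p - int j) | j. j \<le> p} \<union> {(1, -1)}"

(* The formal letter a_{l,m} is the pair (l, m).  Throughout, bounds such as l + m <= p - 1 are
   written without natural-number subtraction, as l + m < p. *)
definition A_alph :: "nat \<Rightarrow> (nat \<times> nat) set" where
  "A_alph p = {(l, m). l + m < p}"

definition tandem_walks :: "nat \<Rightarrow> (int \<times> int) list set" where
  "tandem_walks p = {w \<in> lists (S_alph p). \<forall>u. prefix u w \<longrightarrow> sum_list u \<in> \<nat> \<times> \<nat>}"

type_synonym state = "(nat \<times> nat) list \<times> nat"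

inductive transition ::
    "nat \<Rightarrow> int \<Rightarrow> state \<Rightarrow> state \<Rightarrow> int \<times> int \<Rightarrow> bool"
  for p :: nat where
  T1: "H \<in> lists (A_alph p) \<Longrightarrow>
    transition p (int p) (H, b) (H, b + p) (0, int p)"
| T2: "H \<in> lists (A_alph p) \<Longrightarrow> q < p \<Longrightarrow>
    transition p (int q) (H, 0) (H, q) (0, int p)"
| T3: "H \<in> lists (A_alph p) \<Longrightarrow> l + m < p \<Longrightarrow>
    transition p (-1) (H @ [(l, m)], 0) (H, l) (- int m - 1, int p - int m - 1)"
| T4: "H \<in> lists (A_alph p) \<Longrightarrow> l + m + 1 = p \<Longrightarrow>
    transition p (-1) (H @ [(l, m)], b + 1) (H, b + l + 1) (- int m - 1, int p - int m - 1)"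
| T5: "H \<in> lists (A_alph p) \<Longrightarrow> q < p \<Longrightarrow>
    transition p (int q) (H, b + 1) (H @ [(q, 0)], b) (1, -1)"
| T6: "H \<in> lists (A_alph p) \<Longrightarrow> l + m + 2 \<le> p \<Longrightarrow>
    transition p (-1) (H @ [(l, m)], b + 1) (H @ [(l, m + 1)], b) (1, -1)"
| T7: "transition p (-1) ([], b + 1) ([], b) (1, -1)"

lemma transition_unique:
  assumes "H \<in> lists (A_alph p)" and "a \<in> S_alph p"
  shows "\<exists>!(\<mu>, s). transition p \<mu> s (H, v) a"
proof -
  have ex: "\<exists>\<mu> s. transition p \<mu> s (H, v) a"
  proof -
    consider "a = (0, int p)" | "a = (1, -1)"
      | m where "m < p" "a = (- int m - 1, int p - int m - 1)"
    proof -
      from assms(2) consider "a = (1, -1)" | j where "j \<le> p" "a = (- int j, int p - int j)"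
        by (auto simp: S_alph_def)
      then show thesis
      proof cases
        case (2 j)
        show thesis
        proof (cases j)
          case 0
          with 2 show thesis using that(1) by simp
        next
          case (Suc m)
          with 2 show thesis using that(3)[of m] by simp
        qed
      qed (use that in blast)
    qed
    then show ?thesis
    proof cases
      case 1
      show ?thesis
      proof (cases "v < p")
        case True
        with 1 assms show ?thesis by (blast intro: transition.T2)
      next
        case False
        with 1 assms transition.T1[of H p "v - p"] show ?thesis by auto
      qed
    next
      case 2
      show ?thesis
      proof (cases H rule: rev_cases)
        case Nil
        with 2 show ?thesis by (blast intro: transition.T7)
      next
        case (snoc G x)
        obtain l m where x: "x = (l, m)" by (cases x)
        have G: "G \<in> lists (A_alph p)" and lm: "l + m < p"
          using assms(1) snoc x by (auto simp: A_alph_def)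
        show ?thesis
        proof (cases m)
          case 0
          with G lm 2 snoc x show ?thesis by (auto intro: transition.T5)
        next
          case (Suc k)
          with G lm 2 snoc x transition.T6[of G p l k v] show ?thesis by auto
        qed
      qed
    next
      case (3 m)
      show ?thesis
      proof (cases "v + m < p")
        case True
        with 3 assms show ?thesis by (blast intro: transition.T3)
      next
        case False
        with 3 assms transition.T4[of H p "p - 1 - m" m "v + m - p"] show ?thesis by auto
      qed
    qed
  qed
  have uni: "\<mu> = \<mu>' \<and> s = s'"
    if "transition p \<mu> s (H, v) a" "transition p \<mu>' s' (H, v) a" for \<mu> s \<mu>' s'
    using that by (elim transition.cases) auto
  from ex obtain \<mu> s where t: "transition p \<mu> s (H, v) a" by blast
  show ?thesis
  proof (rule ex1I[of _ "(\<mu>, s)"])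
    fix x assume x: "case x of (\<mu>, s) \<Rightarrow> transition p \<mu> s (H, v) a"
    obtain \<mu>' s' where xs: "x = (\<mu>', s')" by (cases x)
    from x xs have "transition p \<mu>' s' (H, v) a" by simp
    with t have "\<mu>' = \<mu> \<and> s' = s" using uni by blast
    with xs show "x = (\<mu>, s)" by simp
  qed (use t in simp)
qed

(* By transition_unique, the description is proper on all states with a stack in A_p^* and all
   letters of S_p; only such arguments occur when running on a word over S_p. *)
definition reverse_step :: "nat \<Rightarrow> state \<Rightarrow> int \<times> int \<Rightarrow> int \<times> state" where
  "reverse_step p s a = (THE (\<mu>, s'). transition p \<mu> s' s a)"

(* Reads the word from right to left: the recursive call handles the suffix first. *)
fun rl_run :: "nat \<Rightarrow> (int \<times> int) list \<Rightarrow> int list \<times> state" where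
  "rl_run p [] = ([], ([], 0))"
| "rl_run p (a # w) =
    (let (u, s) = rl_run p w; (\<mu>, s') = reverse_step p s a in (\<mu> # u, s'))"

definition Psi :: "nat \<Rightarrow> (int \<times> int) list \<Rightarrow> int list" where
  "Psi p w = fst (rl_run p w)"

datatype dletter = DL (letter: int) (raisability: nat) (modality: int)

(* One step of the raising algorithm.  The index i of the letter being read does not occur, since
   i - 1 = length L.  In raise_down the factorization
     w0 (mu_1)^{j_1,-1} w_1 ... (mu_m)^{j_m,-1} w_m
   is given by w0, the triple (mu_1, j_1, w_1) and the list bs of triples (mu_l, j_l, w_l) for
   l = 2, ..., m. *)
inductive raise_step ::
    "nat \<Rightarrow> dletter list \<Rightarrow> int \<times> int \<Rightarrow> dletter list \<Rightarrow> bool"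
  for p :: nat where
  raise_up: "raise_step p L (0, int p) (L @ [DL 0 p 0])"
| raise_right_zero:
    "\<lbrakk>L = w @ DL \<mu> j 0 # w'; j > 0;
      \<forall>x \<in> set w'. \<not> (raisability x > 0 \<and> modality x \<ge> 0)\<rbrakk> \<Longrightarrow>
     raise_step p L (1, -1) (w @ DL (\<mu> + 1) (j - 1) 0 # w' @ [DL (-1) 1 (-1)])"
| raise_right_pos:
    "\<lbrakk>L = w'' @ DL \<mu>' 0 (-1) # w''' @ DL \<mu> j t # w'; j > 0; t > 0;
      \<forall>x \<in> set w'. \<not> (raisability x > 0 \<and> modality x \<ge> 0);
      int (length w''') = t - 1\<rbrakk> \<Longrightarrow>
     raise_step p L (1, -1)
       (w'' @ DL (\<mu>' + 1) 0 (-1) # w''' @ DL \<mu> (j - 1) t # w' @ [DL (-1) 1 (-1)])"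
| raise_down:
    "\<lbrakk>1 \<le> m; m \<le> p;
      length bs = m - 1;
      L = w\<^sub>0 @ DL \<mu>\<^sub>1 j\<^sub>1 (-1) # w\<^sub>1 @ concat (map (\<lambda>(\<mu>, j, w). DL \<mu> j (-1) # w) bs);
      \<forall>(\<mu>, j, w) \<in> set ((\<mu>\<^sub>1, j\<^sub>1, w\<^sub>1) # bs).
        j > 0 \<and> (\<forall>x \<in> set w. \<not> (raisability x > 0 \<and> modality x = -1));
      d = int (length L) - int (length w\<^sub>0)\<rbrakk> \<Longrightarrow>
     raise_step p L (- int m, int p - int m)
       (w\<^sub>0 @ DL (\<mu>\<^sub>1 + 1) 0 (-1) # w\<^sub>1 @ concat (map (\<lambda>(\<mu>, j, w). DL \<mu> 0 (-1) # w) bs)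
          @ [DL (-1) (p - m) d])"

inductive raise_run :: "nat \<Rightarrow> (int \<times> int) list \<Rightarrow> dletter list \<Rightarrow> bool"
  for p :: nat where
  "raise_run p [] []"
| "raise_run p w L \<Longrightarrow> raise_step p L a L' \<Longrightarrow> raise_run p (w @ [a]) L'"

(* On the input w the raising algorithm runs to completion and returns u. *)
definition raising_output :: "nat \<Rightarrow> (int \<times> int) list \<Rightarrow> int list \<Rightarrow> bool" where
  "raising_output p w u \<longleftrightarrow> (\<exists>L. raise_run p w L \<and> u = map letter L)"

end

theory Submission
  imports Defs
begin

text \<open>
  Running the transducer on a walk u from a state other than the initial one changes its output in a
  controlled way. Increasing the register by one raises a single letter: the surplus
  travels to the left until an up step absorbs it, or until a down step stores it in the letter
  it pushes, from where it reaches the output at the step that pops this letter. Adding a letter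
  (0, m) at the bottom of the stack affects only the m + 1 rightmost steps (1, -1) that meet the
  empty stack in the original run, and raises the leftmost of these. Since the first step of the
  transducer on u followed by a letter a leads from the initial state to one of these two
  perturbations (or to the initial state), decorating the output on u with
  the data of this analysis gives exactly the word maintained by the raising algorithm. Being in
  the quarter plane ensures that every perturbation is absorbed before the left end of u.
\<close>

section \<open>The decorated run of the transducer\<close>

text \<open>From here on words are read from the right, so they are stored reversed, and stacks
  have their top at the head. The abscissa of a letter of S determines it. The result consists
  of the output letter, its raisability and the new state.\<close>

fun act :: "nat \<Rightarrow> state \<Rightarrow> int \<Rightarrow> int \<times> nat \<times> state" where
  "act p (G, v) x =
    (if x = 1 then
       (case G of [] \<Rightarrow> (-1, 1, ([], v + 1))
        | (l, m) # G' \<Rightarrow>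
            if m = 0 then (int l, 0, (G', v + 1)) else (-1, 0, ((l, m - 1) # G', v + 1)))
     else if x = 0 then (int (min v p), p - min v p, (G, v - min v p))
     else let k = nat (- x); l = min v (p - k) in (-1, p - k - l, ((l, k - 1) # G, v - l)))"

text \<open>A stack letter (l, m) needs m + 1 steps (1, -1) to be popped. If the top part of a stack
  needs n such steps in total, its last letter is popped at position \<open>pop_index r n\<close>
  (counted from the left, starting with 0).\<close>

fun pop_index :: "(int \<times> int) list \<Rightarrow> int \<Rightarrow> nat" where
  "pop_index [] n = 0"
| "pop_index (a # r) n = (if n = fst a then length r else pop_index r (n - fst a))"

text \<open>At a down step of a quarter-plane walk this is the distance back to the step that pops
  the letter pushed there, which needs \<open>- x\<close> steps (1, -1). It depends on the walk
  alone, not on the state, so both runs compared later share it.\<close>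

definition modality_at :: "(int \<times> int) list \<Rightarrow> int \<Rightarrow> int" where
  "modality_at r x =
    (if x = 1 then -1 else if x = 0 then 0 else int (length r) - int (pop_index r (- x)))"

fun decorated_run :: "nat \<Rightarrow> (int \<times> int) list \<Rightarrow> state \<Rightarrow> dletter list" where
  "decorated_run p [] s = []"
| "decorated_run p (a # r) s =
    (case act p s (fst a) of
      (\<mu>, j, s') \<Rightarrow> decorated_run p r s' @ [DL \<mu> j (modality_at r (fst a))])"

fun final_state :: "nat \<Rightarrow> (int \<times> int) list \<Rightarrow> state \<Rightarrow> state" where
  "final_state p [] s = s"
| "final_state p (a # r) s = final_state p r (snd (snd (act p s (fst a))))"

declare act.simps [simp del]

lemma act_up: "act p (G, v) 0 = (int (min v p), p - min v p, (G, v - min v p))"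
  by (simp add: act.simps)

lemma act_right:
  "act p ([], v) 1 = (-1, 1, ([], v + 1))"
  "act p ((l, 0) # G, v) 1 = (int l, 0, (G, v + 1))"
  "act p ((l, Suc m) # G, v) 1 = (-1, 0, ((l, m) # G, v + 1))"
  by (simp_all add: act.simps)

lemma act_down:
  "k \<ge> 1 \<Longrightarrow> act p (G, v) (- int k) =
    (-1, p - k - min v (p - k), ((min v (p - k), k - 1) # G, v - min v (p - k)))"
  by (simp add: act.simps Let_def)

lemma modality_at_simps [simp]:
  "modality_at r 1 = -1"
  "modality_at r 0 = 0"
  "k \<ge> 1 \<Longrightarrow> modality_at r (- int k) = int (length r) - int (pop_index r (int k))"
  by (simp_all add: modality_at_def)

lemma pop_index_Cons: "n \<noteq> fst a \<Longrightarrow> n - fst a = n' \<Longrightarrow> pop_index (a # r) n = pop_index r n'"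
  by simp

lemma length_decorated_run [simp]: "length (decorated_run p r s) = length r"
  by (induction r arbitrary: s) (auto split: prod.split)

lemma pop_index_le: "pop_index r n \<le> length r"
  by (induction r arbitrary: n) (auto intro: le_SucI)

lemma modality_at_nonneg: "x \<noteq> 1 \<Longrightarrow> modality_at r x \<ge> 0"
  using pop_index_le[of r "- x"] by (simp add: modality_at_def)

lemma S_alph_cases [consumes 1, case_names up right down]:
  assumes "a \<in> S_alph p"
  obtains "a = (0, int p)" | "a = (1, -1)"
  | k where "1 \<le> k" "k \<le> p" "a = (- int k, int p - int k)"
proof -
  from assms consider "a = (1, -1)" | j where "j \<le> p" "a = (- int j, int p - int j)"
    by (auto simp: S_alph_def)
  then show thesis
  proof cases
    case (2 j)
    then show thesis using that(1) that(3)[of j] by (cases "j = 0") auto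
  qed (use that in blast)
qed

section \<open>Agreement with the transducer\<close>

lemma reverse_step_eqI:
  assumes "H \<in> lists (A_alph p)" "a \<in> S_alph p" "transition p \<mu> s (H, v) a"
  shows "reverse_step p (H, v) a = (\<mu>, s)"
  unfolding reverse_step_def
  by (rule the1_equality[OF transition_unique[OF assms(1,2)]]) (use assms(3) in simp)

lemma act_reverse_step:
  assumes "a \<in> S_alph p" "set G \<subseteq> A_alph p" "act p (G, v) (fst a) = (\<mu>, j, (G', v'))"
  shows "reverse_step p (rev G, v) a = (\<mu>, (rev G', v')) \<and> set G' \<subseteq> A_alph p \<and> \<mu> \<in> Sigma_alph p"
proof -
  have G: "rev G \<in> lists (A_alph p)"
    using assms(2) by auto
  have "transition p \<mu> (rev G', v') (rev G, v) a \<and> set G' \<subseteq> A_alph p \<and> \<mu> \<in> Sigma_alph p"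
    using assms(1)
  proof (cases rule: S_alph_cases)
    case up
    show ?thesis
    proof (cases "v < p")
      case True
      then show ?thesis using transition.T2[OF G True] assms up
        by (auto simp: act_up Sigma_alph_def)
    next
      case False
      then show ?thesis using transition.T1[OF G, of "v - p"] assms up
        by (auto simp: act_up Sigma_alph_def min_def)
    qed
  next
    case right
    show ?thesis
    proof (cases G)
      case Nil
      then show ?thesis using transition.T7[of p v] assms right
        by (auto simp: act_right Sigma_alph_def)
    next
      case (Cons x K)
      obtain l m where x: "x = (l, m)" by (cases x)
      have K: "rev K \<in> lists (A_alph p)" "set K \<subseteq> A_alph p" "l + m < p"
        using assms(2) Cons x by (auto simp: A_alph_def)
      show ?thesis
      proof (cases m)
        case 0
        then show ?thesis using transition.T5[of "rev K" p l v] assms right K Cons x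
          by (auto simp: act_right Sigma_alph_def)
      next
        case (Suc n)
        then show ?thesis using transition.T6[of "rev K" p l n v] assms right K Cons x
          by (auto simp: act_right Sigma_alph_def A_alph_def)
      qed
    qed
  next
    case (down k)
    then have a: "a = (- int (k - 1) - 1, int p - int (k - 1) - 1)"
      by (simp add: of_nat_diff)
    let ?l = "min v (p - k)"
    have out: "\<mu> = -1" "G' = (?l, k - 1) # G" "v' = v - ?l"
      using assms(3) down by (simp_all add: act_down)
    have "transition p (-1) (rev G @ [(?l, k - 1)], v - ?l) (rev G, v) a"
    \<comment> \<open>\<open>T3\<close> covers a register that fits into the pushed letter, boundary
      included; \<open>T4\<close> leaves at least 1 behind.\<close>
    proof (cases "v \<le> p - k")
      case True
      with down have "v + (k - 1) < p" by simp
      from transition.T3[OF G this] True show ?thesis by (simp add: a)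
    next
      case False
      then have "Suc (p - k) \<le> v" by simp
      then obtain u where u: "v = Suc (p - k) + u"
        using le_Suc_ex by blast
      have "p - k + (k - 1) + 1 = p" using down by simp
      from transition.T4[OF G this, of u] show ?thesis by (simp add: a u add.commute)
    qed
    moreover have "?l + (k - 1) < p"
      using down by simp
    ultimately show ?thesis
      using assms(2) by (simp add: out A_alph_def Sigma_alph_def)
  qed
  then show ?thesis using reverse_step_eqI[OF G assms(1)] by blast
qed

lemma final_state_append: "final_state p (r @ r') s = final_state p r' (final_state p r s)"
  by (induction r arbitrary: s) auto

lemma letters_decorated_run_append:
  "map letter (decorated_run p (r @ r') s) =
    map letter (decorated_run p r' (final_state p r s)) @ map letter (decorated_run p r s)"
  by (induction r arbitrary: s) (auto split: prod.split)

lemma rl_run_eq: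
  assumes "w \<in> lists (S_alph p)"
  shows "rl_run p w = (map letter (decorated_run p (rev w) ([], 0)),
      map_prod rev id (final_state p (rev w) ([], 0))) \<and>
    set (fst (final_state p (rev w) ([], 0))) \<subseteq> A_alph p \<and>
    fst (rl_run p w) \<in> lists (Sigma_alph p)"
  using assms
proof (induction w)
  case (Cons a w)
  obtain G v where Gv: "final_state p (rev w) ([], 0) = (G, v)" by fastforce
  obtain \<mu> j G' v' where act: "act p (G, v) (fst a) = (\<mu>, j, (G', v'))"
    by (metis prod_cases4)
  from Cons act_reverse_step[OF _ _ act] Gv show ?case
    by (auto simp: act final_state_append letters_decorated_run_append)
qed simp

section \<open>Perturbations of the run\<close>

text \<open>The tails of a reversed walk are its reversed prefixes, so inductions reading from the
  right keep this condition.\<close>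

fun quarter_plane :: "nat \<Rightarrow> (int \<times> int) list \<Rightarrow> bool" where
  "quarter_plane p [] \<longleftrightarrow> True"
| "quarter_plane p (a # r) \<longleftrightarrow> quarter_plane p r \<and> a \<in> S_alph p \<and>
    0 \<le> fst (sum_list (a # r)) \<and> 0 \<le> snd (sum_list (a # r))"

text \<open>The number of steps (1, -1) that empty the stack. Each letter read changes it and the
  abscissa of the unread part by the same amount, except when (1, -1) meets the empty stack.\<close>

definition weight :: "(nat \<times> nat) list \<Rightarrow> int" where
  "weight G = sum_list (map (\<lambda>(l, m). int m + 1) G)"

lemma weight_simps [simp]:
  "weight [] = 0"
  "weight ((l, m) # G) = int m + 1 + weight G"
  "weight (G @ G') = weight G + weight G'"
  by (simp_all add: weight_def)

lemma weight_nonneg: "weight G \<ge> 0"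
  by (auto simp: weight_def intro!: sum_list_nonneg)

lemma quarter_plane_sum_nonneg:
  "quarter_plane p r \<Longrightarrow> 0 \<le> fst (sum_list r) \<and> 0 \<le> snd (sum_list r)"
  by (cases r) auto

text \<open>The first component of a stack letter is merely carried along until it is written at the
  pop; from there on both runs are in the same state. The two sides of the bound keep a fixed
  difference, so the pop occurs inside \<open>r\<close>.\<close>

lemma raise_stack_letter:
  assumes "quarter_plane p r" "weight K + int m + 1 \<le> fst (sum_list r)"
  shows "\<exists>A \<mu> C. decorated_run p r (K @ (l, m) # B, v) = A @ DL \<mu> 0 (-1) # C \<and>
    decorated_run p r (K @ (l + 1, m) # B, v) = A @ DL (\<mu> + 1) 0 (-1) # C \<and>
    length A = pop_index r (weight K + int m + 1)"
  using assms
proof (induction r arbitrary: K m v)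
  case Nil
  then have "weight K + int m + 1 \<le> 0" by simp
  with weight_nonneg[of K] have False by linarith
  then show ?case ..
next
  case (Cons a r)
  have qp: "quarter_plane p r" and "a \<in> S_alph p"
    using Cons.prems by auto
  note pop = pop_index_Cons[of "weight K + int m + 1" a _ r] and nonneg = weight_nonneg[of K]
  from \<open>a \<in> S_alph p\<close> show ?case
  proof (cases rule: S_alph_cases)
    case up
    have "pop_index (a # r) (weight K + int m + 1) = pop_index r (weight K + int m + 1)"
      by (rule pop) (use up nonneg in simp_all)
    with Cons.IH[OF qp, of K m "v - min v p"] Cons.prems up show ?thesis
      by (fastforce simp: act_up simp del: pop_index.simps)
  next
    case right
    show ?thesis
    proof (cases K)
      case Nil
      show ?thesis
      proof (cases m)
        case 0
        with Nil right show ?thesis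
          by (intro exI[of _ "decorated_run p r (B, v + 1)"] exI[of _ "int l"] exI[of _ "[]"])
            (simp add: act_right)
      next
        case (Suc n)
        have "pop_index (a # r) (weight K + int m + 1) = pop_index r (int n + 1)"
          by (rule pop) (use right Nil Suc in simp_all)
        with Cons.IH[OF qp, of "[]" n "v + 1"] Cons.prems Nil Suc right show ?thesis
          by (fastforce simp: act_right simp del: pop_index.simps)
      qed
    next
      case (Cons x K')
      obtain l' m' where x: "x = (l', m')" by (cases x)
      note nonneg' = weight_nonneg[of K']
      show ?thesis
      proof (cases m')
        case 0
        have "pop_index (a # r) (weight K + int m + 1) = pop_index r (weight K' + int m + 1)"
          by (rule pop) (use right Cons x 0 nonneg' in simp_all)
        with Cons.IH[OF qp, of K' m "v + 1"] Cons.prems 0 x Cons right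
        show ?thesis by (fastforce simp: act_right simp del: pop_index.simps)
      next
        case (Suc n)
        have "pop_index (a # r) (weight K + int m + 1) =
            pop_index r (weight ((l', n) # K') + int m + 1)"
          by (rule pop) (use right Cons x Suc nonneg' in simp_all)
        with Cons.IH[OF qp, of "(l', n) # K'" m "v + 1"] Cons.prems Suc x Cons right
        show ?thesis by (fastforce simp: act_right simp del: pop_index.simps)
      qed
    qed
  next
    case (down k)
    let ?l = "min v (p - k)"
    have "pop_index (a # r) (weight K + int m + 1) =
        pop_index r (weight ((?l, k - 1) # K) + int m + 1)"
      by (rule pop) (use down nonneg in \<open>simp_all add: of_nat_diff\<close>)
    with Cons.IH[OF qp, of "(?l, k - 1) # K" m "v - ?l"] Cons.prems down
    show ?thesis by (fastforce simp: act_down of_nat_diff simp del: pop_index.simps)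
  qed
qed

text \<open>In the induction \<open>W\<close> gathers the letters the surplus has passed: steps (1,
  -1), of modality -1, and up or down steps of raisability 0. Hence it stops at the rightmost letter
  the algorithm may choose. For empty \<open>r\<close> the ordinate bound would read
  \<open>v + 1 \<le> 0\<close>, so the surplus stops in time.\<close>

lemma raise_register:
  assumes "quarter_plane p r" "weight G \<le> fst (sum_list r)" "int v + 1 \<le> snd (sum_list r)"
    and "\<forall>x \<in> set W. \<not> (raisability x > 0 \<and> modality x \<ge> 0)"
  shows "raise_step p (decorated_run p r (G, v) @ W) (1, -1)
    (decorated_run p r (G, v + 1) @ W @ [DL (-1) 1 (-1)])"
  using assms
proof (induction r arbitrary: G v W)
  case (Cons a r)
  have qp: "quarter_plane p r" and "a \<in> S_alph p"
    using Cons.prems by auto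
  note nonneg = quarter_plane_sum_nonneg[OF qp]
  from \<open>a \<in> S_alph p\<close> show ?case
  proof (cases rule: S_alph_cases)
    case up
    show ?thesis
    proof (cases "v < p")
      case True
      with raise_right_zero[of _ "decorated_run p r (G, 0)" "int v" "p - v" W p] Cons.prems up
      show ?thesis by (simp add: act_up ac_simps)
    next
      case False
      then obtain u where "v = p + u"
        using le_Suc_ex[of p v] by auto
      with Cons.IH[OF qp, of G u "DL (int p) 0 0 # W"] Cons.prems up
      show ?thesis by (simp add: act_up)
    qed
  next
    case right
    \<comment> \<open>A step (1, -1) acts alike for every register value, so the surplus passes
      it.\<close>
    obtain \<mu> j G' where act: "\<And>u. act p (G, u) 1 = (\<mu>, j, (G', u + 1))"
        and "weight G' \<le> fst (sum_list r)"
    proof (cases G)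
      case Nil
      with nonneg that show thesis by (auto simp: act_right)
    next
      case (Cons x K)
      obtain l m where x: "x = (l, m)" by (cases x)
      with Cons Cons.prems right nonneg that show thesis
        by (cases m) (auto simp: act_right)
    qed
    with Cons.IH[OF qp, of G' "v + 1" "DL \<mu> j (-1) # W"] Cons.prems right
    show ?thesis by simp
  next
    case (down k)
    let ?t = "modality_at r (- int k)"
    show ?thesis
    proof (cases "v < p - k")
      case True
      then have "min v (p - k) = v" "min (v + 1) (p - k) = v + 1"
        by simp_all
      then have run: "decorated_run p (a # r) (G, v) =
          decorated_run p r ((v, k - 1) # G, 0) @ [DL (-1) (p - k - v) ?t]"
        "decorated_run p (a # r) (G, v + 1) =
          decorated_run p r ((v + 1, k - 1) # G, 0) @ [DL (-1) (p - k - v - 1) ?t]"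
        using down by (simp_all add: act_down)
      have "weight [] + int (k - 1) + 1 \<le> fst (sum_list r)"
        using Cons.prems(2) down weight_nonneg[of G] by (simp add: of_nat_diff)
      then obtain A \<mu> C where AC:
        "decorated_run p r ((v, k - 1) # G, 0) = A @ DL \<mu> 0 (-1) # C"
        "decorated_run p r ((v + 1, k - 1) # G, 0) = A @ DL (\<mu> + 1) 0 (-1) # C"
        "length A = pop_index r (int k)"
        using raise_stack_letter[OF qp, of "[]" "k - 1" v G 0] down by (auto simp: of_nat_diff)
      \<comment> \<open>\<open>C\<close> is the stretch strictly between the pop and the push,
        whence the \<open>t - 1\<close> in \<open>raise_right_pos\<close>.\<close>
      have "length r = length A + length C + 1"
        using arg_cong[OF AC(1), of length] by simp
      then have t: "?t > 0" "int (length C) = ?t - 1"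
        using AC(3) down(1) by simp_all
      have "p - k - v > 0" using True by simp
      from raise_right_pos[OF refl this t(1) Cons.prems(4) t(2), of p A \<mu> "-1"]
      show ?thesis unfolding run AC by simp
    next
      case False
      then have "min v (p - k) = p - k" "min (v + 1) (p - k) = p - k"
        and v: "v + 1 - (p - k) = v - (p - k) + 1" "p - k \<le> v"
        by simp_all
      then have run: "decorated_run p (a # r) (G, v) =
          decorated_run p r ((p - k, k - 1) # G, v - (p - k)) @ [DL (-1) 0 ?t]"
        "decorated_run p (a # r) (G, v + 1) =
          decorated_run p r ((p - k, k - 1) # G, v - (p - k) + 1) @ [DL (-1) 0 ?t]"
        using down by (simp_all add: act_down)
      have "weight ((p - k, k - 1) # G) \<le> fst (sum_list r)"
        "int (v - (p - k)) + 1 \<le> snd (sum_list r)"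
        using Cons.prems(2,3) down v(2) by (simp_all add: of_nat_diff)
      from Cons.IH[OF qp this, of "DL (-1) 0 ?t # W"] Cons.prems(4)
      show ?thesis unfolding run by simp
    qed
  qed
qed simp

text \<open>Where the original run meets the empty stack and writes -1 with raisability 1, the
  perturbed run works on the extra letter instead and writes -1 with raisability 0, or 0 when
  popping it. \<open>bs\<close> holds the blocks already found, \<open>W\<close> the letters read
  since; \<open>m + 1\<close> blocks are still to come.\<close>

lemma insert_stack_bottom:
  assumes "quarter_plane p r" "weight G + int m + 1 \<le> fst (sum_list r)"
    and "\<forall>x \<in> set W. \<not> (raisability x > 0 \<and> modality x = -1)"
    and "\<forall>(\<mu>, j, u) \<in> set bs. j > 0 \<and> (\<forall>x \<in> set u. \<not> (raisability x > 0 \<and> modality x = -1))"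
    and "m + length bs + 1 = k" "k \<le> p"
    and "L = decorated_run p r (G, v) @ W @ concat (map (\<lambda>(\<mu>, j, u). DL \<mu> j (-1) # u) bs)"
  shows "raise_step p L (- int k, int p - int k)
    (decorated_run p r (G @ [(0, m)], v) @ W @ concat (map (\<lambda>(\<mu>, j, u). DL \<mu> 0 (-1) # u) bs)
      @ [DL (-1) (p - k) (int (length L) - int (pop_index r (weight G + int m + 1)))])"
  using assms
proof (induction r arbitrary: G v W m bs)
  case Nil
  then have "weight G + int m + 1 \<le> 0" by simp
  with weight_nonneg[of G] have False by linarith
  then show ?case ..
next
  case (Cons a r)
  have qp: "quarter_plane p r" and "a \<in> S_alph p"
    using Cons.prems by auto
  note pop = pop_index_Cons[of "weight G + int m + 1" a _ r] and nonneg = weight_nonneg[of G]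
  from \<open>a \<in> S_alph p\<close> show ?case
  proof (cases rule: S_alph_cases)
    case up
    let ?q = "min v p"
    have "pop_index (a # r) (weight G + int m + 1) = pop_index r (weight G + int m + 1)"
      by (rule pop) (use up nonneg in simp_all)
    with Cons.IH[OF qp, of G m "DL (int ?q) (p - ?q) 0 # W" bs "v - ?q"] Cons.prems up
    show ?thesis by (simp add: act_up del: pop_index.simps)
  next
    case right
    show ?thesis
    proof (cases G)
      case Nil
      show ?thesis
      proof (cases m)
        case 0
        \<comment> \<open>Popping (0, 0) writes 0 = -1 + 1 and leaves both runs in
          \<open>([], v + 1)\<close>, so everything further left is common.\<close>
        with Nil right Cons.prems raise_down[of k p bs L "decorated_run p r ([], v + 1)" "-1" 1 W]
        show ?thesis by (simp add: act_right)
      next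
        case (Suc n)
        have "pop_index (a # r) (weight G + int m + 1) = pop_index r (int n + 1)"
          by (rule pop) (use right Nil Suc in simp_all)
        \<comment> \<open>This letter heads a new block with tail \<open>W\<close>, and the
          gathering restarts with an empty word.\<close>
        with Suc Cons.IH[OF qp, of "[]" n "[]" "(-1, 1, W) # bs" "v + 1"] Cons.prems Nil right
        show ?thesis by (simp add: act_right del: pop_index.simps)
      qed
    next
      case (Cons x K)
      obtain l n where x: "x = (l, n)" by (cases x)
      note nonneg' = weight_nonneg[of K]
      show ?thesis
      proof (cases n)
        case 0
        have "pop_index (a # r) (weight G + int m + 1) = pop_index r (weight K + int m + 1)"
          by (rule pop) (use right Cons x 0 nonneg' in simp_all)
        with 0 Cons.IH[OF qp, of K m "DL (int l) 0 (-1) # W" bs "v + 1"] Cons.prems right Cons x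
        show ?thesis by (simp add: act_right del: pop_index.simps)
      next
        case (Suc n')
        have "pop_index (a # r) (weight G + int m + 1) =
            pop_index r (weight ((l, n') # K) + int m + 1)"
          by (rule pop) (use right Cons x Suc nonneg' in simp_all)
        with Suc Cons.IH[OF qp, of "(l, n') # K" m "DL (-1) 0 (-1) # W" bs "v + 1"] Cons.prems
          right Cons x
        show ?thesis by (simp add: act_right del: pop_index.simps)
      qed
    qed
  next
    case (down i)
    let ?l = "min v (p - i)"
    have "pop_index (a # r) (weight G + int m + 1) =
        pop_index r (weight ((?l, i - 1) # G) + int m + 1)"
      by (rule pop) (use down nonneg in \<open>simp_all add: of_nat_diff\<close>)
    \<comment> \<open>Whatever its raisability, a down step never heads a block.\<close>
    moreover have "modality_at r (- int i) \<noteq> -1"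
      using modality_at_nonneg[of "- int i" r] by linarith
    ultimately show ?thesis
      using Cons.IH[OF qp, of "(?l, i - 1) # G" m
        "DL (-1) (p - i - ?l) (modality_at r (- int i)) # W" bs "v - ?l"] Cons.prems down
      by (simp add: act_down of_nat_diff del: pop_index.simps)
  qed
qed

text \<open>The endpoint of the walk supplies the bounds: before a final (1, -1) the ordinate is at
  least 1, before a final down step by \<open>k\<close> the abscissa is at least
  \<open>k\<close>.\<close>

lemma raise_step_decorated_run:
  assumes "quarter_plane p (a # r)"
  shows "raise_step p (decorated_run p r ([], 0)) a (decorated_run p (a # r) ([], 0))"
proof -
  have qp: "quarter_plane p r" and "a \<in> S_alph p"
    using assms by auto
  note nonneg = quarter_plane_sum_nonneg[OF qp]
  from \<open>a \<in> S_alph p\<close> show ?thesis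
  proof (cases rule: S_alph_cases)
    case up
    with raise_up[of p "decorated_run p r ([], 0)"] show ?thesis by (simp add: act_up)
  next
    case right
    with raise_register[OF qp, of "[]" 0 "[]"] assms nonneg show ?thesis
      by (simp add: act_right)
  next
    case (down k)
    with insert_stack_bottom[OF qp, of "[]" "k - 1" "[]" "[]" k _ 0] assms nonneg show ?thesis
      by (simp add: act_down of_nat_diff)
  qed
qed

section \<open>The raising algorithm is deterministic\<close>

lemma split_at_last_unique:
  assumes "u @ x # w = u' @ x' # w'" "P x" "P x'" "\<forall>y \<in> set w. \<not> P y" "\<forall>y \<in> set w'. \<not> P y"
  shows "u = u' \<and> x = x' \<and> w = w'"
proof -
  \<comment> \<open>Read backwards, the part after the last letter satisfying \<open>P\<close> is
    the longest initial segment avoiding \<open>P\<close>.\<close>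
  have *: "takeWhile (\<lambda>y. \<not> P y) (rev (v @ z # t)) = rev t"
    if "P z" "\<forall>y \<in> set t. \<not> P y" for v z t
    using that by (simp add: takeWhile_append)
  have "rev w = rev w'"
    using *[of x w u] *[of x' w' u'] assms by simp
  with assms(1) show ?thesis by simp
qed

text \<open>Blocks are peeled off from the right, each beginning at the last raisable letter of
  modality -1. Fixing their number determines \<open>w\<close>, which may itself contain such
  letters.\<close>

lemma blocks_unique:
  assumes "w @ concat (map (\<lambda>(\<mu>, j, u). DL \<mu> j (-1) # u) xs) =
      w' @ concat (map (\<lambda>(\<mu>, j, u). DL \<mu> j (-1) # u) ys)"
    and "length xs = length ys"
    and "\<forall>(\<mu>, j, u) \<in> set xs. j > 0 \<and> (\<forall>x \<in> set u. \<not> (raisability x > 0 \<and> modality x = -1))"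
    and "\<forall>(\<mu>, j, u) \<in> set ys. j > 0 \<and> (\<forall>x \<in> set u. \<not> (raisability x > 0 \<and> modality x = -1))"
  shows "w = w' \<and> xs = ys"
  using assms
proof (induction xs arbitrary: ys rule: rev_induct)
  case (snoc x xs)
  obtain y zs where ys: "ys = zs @ [y]"
    using snoc.prems(2) by (cases ys rule: rev_cases) auto
  obtain \<mu> j u where x: "x = (\<mu>, j, u)" by (cases x)
  obtain \<mu>' j' u' where y: "y = (\<mu>', j', u')" by (cases y)
  let ?b = "\<lambda>xs. concat (map (\<lambda>(\<mu>, j, u). DL \<mu> j (-1) # u) xs)"
  have "w @ ?b xs = w' @ ?b zs \<and> DL \<mu> j (-1) = DL \<mu>' j' (-1) \<and> u = u'"
    using snoc.prems unfolding ys x y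
    by (intro split_at_last_unique[where P = "\<lambda>x. raisability x > 0 \<and> modality x = -1"]) auto
  with snoc.IH[of zs] snoc.prems show ?case by (simp add: ys x y)
qed simp

lemma raise_step_right_cases:
  assumes "raise_step p L (1, -1) L'"
  obtains (zero) w \<mu> j w' where "L = w @ DL \<mu> j 0 # w'" "j > 0"
    "\<forall>x \<in> set w'. \<not> (raisability x > 0 \<and> modality x \<ge> 0)"
    "L' = w @ DL (\<mu> + 1) (j - 1) 0 # w' @ [DL (-1) 1 (-1)]"
  | (pos) w'' \<mu>' w''' \<mu> j t w' where "L = w'' @ DL \<mu>' 0 (-1) # w''' @ DL \<mu> j t # w'"
    "j > 0" "t > 0" "\<forall>x \<in> set w'. \<not> (raisability x > 0 \<and> modality x \<ge> 0)"
    "int (length w''') = t - 1"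
    "L' = w'' @ DL (\<mu>' + 1) 0 (-1) # w''' @ DL \<mu> (j - 1) t # w' @ [DL (-1) 1 (-1)]"
  using assms by (cases rule: raise_step.cases) (simp; blast)+

lemma raise_step_right_unique:
  assumes "raise_step p L (1, -1) L1" "raise_step p L (1, -1) L2"
  shows "L1 = L2"
proof -
  note split = split_at_last_unique[where P = "\<lambda>x. raisability x > 0 \<and> modality x \<ge> 0"]
  show ?thesis
    using assms(1)
  proof (cases rule: raise_step_right_cases)
    case (zero w \<mu> j w')
    note L1 = this
    show ?thesis
      using assms(2)
    proof (cases rule: raise_step_right_cases)
      case (zero v \<nu> i v')
      from split[of w "DL \<mu> j 0" w' v "DL \<nu> i 0" v'] L1 zero show ?thesis by simp
    next
      case (pos v'' \<nu>' v''' \<nu> i t v')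
      from split[of w "DL \<mu> j 0" w' "v'' @ DL \<nu>' 0 (-1) # v'''" "DL \<nu> i t" v'] L1 pos
      show ?thesis by simp
    qed
  next
    case (pos w'' \<mu>' w''' \<mu> j s w')
    note L1 = this
    show ?thesis
      using assms(2)
    proof (cases rule: raise_step_right_cases)
      case (zero v \<nu> i v')
      from split[of v "DL \<nu> i 0" v' "w'' @ DL \<mu>' 0 (-1) # w'''" "DL \<mu> j s" w'] L1 zero
      show ?thesis by simp
    next
      case (pos v'' \<nu>' v''' \<nu> i t v')
      from split[of "w'' @ DL \<mu>' 0 (-1) # w'''" "DL \<mu> j s" w'
          "v'' @ DL \<nu>' 0 (-1) # v'''" "DL \<nu> i t" v'] L1 pos
      have eq: "w'' @ DL \<mu>' 0 (-1) # w''' = v'' @ DL \<nu>' 0 (-1) # v'''"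
        "\<mu> = \<nu>" "j = i" "s = t" "w' = v'"
        by auto
      \<comment> \<open>Equal modalities put the raised letter at the same distance.\<close>
      with L1 pos have "length w''' = length v'''" by simp
      with eq L1 pos show ?thesis by simp
    qed
  qed
qed

text \<open>The distinguished first block is merged into the list, the form that
  \<open>blocks_unique\<close> expects.\<close>

lemma raise_step_down_cases:
  assumes "raise_step p L (- int k, int p - int k) L'" "1 \<le> k"
  obtains w \<mu> j u bs where "length bs = k - 1"
    "L = w @ concat (map (\<lambda>(\<mu>, j, u). DL \<mu> j (-1) # u) ((\<mu>, j, u) # bs))"
    "\<forall>(\<mu>, j, u) \<in> set ((\<mu>, j, u) # bs).
      j > 0 \<and> (\<forall>x \<in> set u. \<not> (raisability x > 0 \<and> modality x = -1))"
    "L' = w @ DL (\<mu> + 1) 0 (-1) # u @ concat (map (\<lambda>(\<mu>, j, u). DL \<mu> 0 (-1) # u) bs)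
      @ [DL (-1) (p - k) (int (length L) - int (length w))]"
  using assms(1)
proof (cases rule: raise_step.cases)
  case (raise_down m bs w \<mu> j u d)
  with that[of bs w \<mu> j u] show thesis by simp
qed (use assms(2) in auto)

lemma raise_step_down_unique:
  assumes "raise_step p L (- int k, int p - int k) L1" "raise_step p L (- int k, int p - int k) L2"
    and "1 \<le> k"
  shows "L1 = L2"
proof -
  obtain w \<mu> j u bs where 1: "length bs = k - 1"
    "L = w @ concat (map (\<lambda>(\<mu>, j, u). DL \<mu> j (-1) # u) ((\<mu>, j, u) # bs))"
    "\<forall>(\<mu>, j, u) \<in> set ((\<mu>, j, u) # bs).
      j > 0 \<and> (\<forall>x \<in> set u. \<not> (raisability x > 0 \<and> modality x = -1))"
    "L1 = w @ DL (\<mu> + 1) 0 (-1) # u @ concat (map (\<lambda>(\<mu>, j, u). DL \<mu> 0 (-1) # u) bs)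
      @ [DL (-1) (p - k) (int (length L) - int (length w))]"
    using raise_step_down_cases[OF assms(1,3)] .
  obtain w' \<mu>' j' u' bs' where 2: "length bs' = k - 1"
    "L = w' @ concat (map (\<lambda>(\<mu>, j, u). DL \<mu> j (-1) # u) ((\<mu>', j', u') # bs'))"
    "\<forall>(\<mu>, j, u) \<in> set ((\<mu>', j', u') # bs').
      j > 0 \<and> (\<forall>x \<in> set u. \<not> (raisability x > 0 \<and> modality x = -1))"
    "L2 = w' @ DL (\<mu>' + 1) 0 (-1) # u' @ concat (map (\<lambda>(\<mu>, j, u). DL \<mu> 0 (-1) # u) bs')
      @ [DL (-1) (p - k) (int (length L) - int (length w'))]"
    using raise_step_down_cases[OF assms(2,3)] .
  have "w = w' \<and> (\<mu>, j, u) # bs = (\<mu>', j', u') # bs'"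
    by (rule blocks_unique) (use 1 2 in simp_all)
  with 1(4) 2(4) show ?thesis by simp
qed

lemma raise_step_unique:
  assumes "a \<in> S_alph p" "raise_step p L a L1" "raise_step p L a L2"
  shows "L1 = L2"
  using assms(1)
proof (cases rule: S_alph_cases)
  case up
  have "L' = L @ [DL 0 p 0]" if "raise_step p L (0, int p) L'" for L'
    using that by (cases rule: raise_step.cases) auto
  with assms up show ?thesis by blast
next
  case right
  with assms raise_step_right_unique show ?thesis by blast
next
  case (down k)
  with assms raise_step_down_unique show ?thesis by blast
qed

section \<open>Complete runs of the raising algorithm and the conclusion\<close>

lemma raise_run_snoc_iff:
  "raise_run p (w @ [a]) L' \<longleftrightarrow> (\<exists>L. raise_run p w L \<and> raise_step p L a L')"
  by (subst raise_run.simps) auto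

text \<open>\<open>raise_step_decorated_run\<close> shows that the required factorizations exist,
  \<open>raise_step_unique\<close> that no other run is possible.\<close>

lemma raise_run_iff_decorated_run:
  assumes "quarter_plane p (rev w)"
  shows "raise_run p w L \<longleftrightarrow> L = decorated_run p (rev w) ([], 0)"
  using assms
proof (induction w arbitrary: L rule: rev_induct)
  case Nil
  show ?case by (subst raise_run.simps) auto
next
  case (snoc a w)
  then have qp: "quarter_plane p (a # rev w)" by simp
  with snoc.IH have "raise_run p (w @ [a]) L \<longleftrightarrow>
      raise_step p (decorated_run p (rev w) ([], 0)) a L"
    by (simp add: raise_run_snoc_iff)
  also have "\<dots> \<longleftrightarrow> L = decorated_run p (a # rev w) ([], 0)"
    using raise_step_unique[of a p] raise_step_decorated_run[OF qp] qp by auto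
  finally show ?case by simp
qed

lemma quarter_plane_rev:
  assumes "w \<in> tandem_walks p"
  shows "quarter_plane p (rev w)"
  using assms
proof (induction w rule: rev_induct)
  case (snoc a w)
  have "w \<in> tandem_walks p"
    using snoc.prems by (auto simp: tandem_walks_def)
  moreover have "sum_list (w @ [a]) \<in> \<nat> \<times> \<nat>" "a \<in> S_alph p"
    using snoc.prems by (auto simp: tandem_walks_def simp del: sum_list.append)
  moreover have "0 \<le> x" if "x \<in> \<nat>" for x :: int
    using that by (auto elim: Nats_cases)
  ultimately show ?case
    using snoc.IH by (auto simp: add.commute mem_Times_iff)
qed simp

theorem theorem13:
  fixes p :: nat and w :: "(int \<times> int) list"
  assumes "p \<ge> 1" and "w \<in> tandem_walks p"
  shows "Psi p w \<in> lists (Sigma_alph p) \<and>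
    (\<forall>u. raising_output p w u \<longleftrightarrow> u = Psi p w)"
proof -
  have "w \<in> lists (S_alph p)"
    using assms(2) by (simp add: tandem_walks_def)
  note run = rl_run_eq[OF this]
  then have "Psi p w = map letter (decorated_run p (rev w) ([], 0))"
    by (simp add: Psi_def)
  with run raise_run_iff_decorated_run[OF quarter_plane_rev[OF assms(2)]] show ?thesis
    by (auto simp: raising_output_def Psi_def)
qed

end
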